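(* Let $(X,d_X)$ and $(Y,d_Y)$ be metric spaces, and let $\varphi:Y\to X$ and $h:Y\to\mathbb{R}$ be maps. Suppose that one of the following holds: (i) $Tf=h\cdot (f\circ\varphi)$ defines a bijection $T:\mathrm{Lip}(X)\to\mathrm{Lip}(Y)$ with $L(Tf)=L(f)$ for all $f\in\mathrm{Lip}(X)$; or (ii) $X$ and $Y$ are quasi-convex and $Tf=h\cdot (f\circ\varphi)$ defines a bijection $T:\mathrm{Lip}^b(X)\to\mathrm{Lip}^b(Y)$ with $L(Tf)=L(f)$ for all $f\in\mathrm{Lip}^b(X)$. Then there is a scalar $\alpha>0$ such that $\varphi$ is an $\alpha$-dilation from $Y$ onto a dense subset $X_0=\varphi(Y)$ of $X$, and $h$ is a constant function with value either $1/\alpha$ or $-1/\alpha$. If, moreover, $Y$ is complete, then $\varphi(Y)=X$.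
   Context: All vector spaces are over $\mathbb{R}$. For a metric space $(X,d_X)$ and $f:X\to\mathbb{R}$, the Lipschitz constant is $L(f)=\sup_{x\neq y\in X}\frac{|f(x)-f(y)|}{d_X(x,y)}$. $\mathrm{Lip}(X)$ is the real vector space of all $f:X\to\mathbb{R}$ with $L(f)<+\infty$, and $\mathrm{Lip}^b(X)$ is the subspace of bounded functions in $\mathrm{Lip}(X)$. For $\alpha>0$, an $\alpha$-dilation is a map $\varphi:Y\to X$ with $d_X(\varphi(u),\varphi(v))=\alpha\, d_Y(u,v)$ for all $u,v\in Y$. A metric space $(X,d_X)$ is quasi-convex if there is a constant $C>0$ such that any $x,y\in X$ can be joined by a continuous path in $X$ of length at most $C\,d_X(x,y)$. *)

theory Defs
  imports "HOL-Analysis.Analysis"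
begin

text \<open>The supremum is taken in the extended nonnegative reals, so that it may be infinite; on a
  one-point space it is the supremum of the empty set, which is 0 there.\<close>

definition Lip_const :: "('a::metric_space \<Rightarrow> real) \<Rightarrow> ennreal" where
  "Lip_const f = (SUP (x, y)\<in>{(x, y). x \<noteq> y}. ennreal (\<bar>f x - f y\<bar> / dist x y))"

definition Lip :: "('a::metric_space \<Rightarrow> real) set" where
  "Lip = {f. Lip_const f < \<infinity>}"

definition Lip_bdd :: "('a::metric_space \<Rightarrow> real) set" where
  "Lip_bdd = {f \<in> Lip. bounded (range f)}"

definition dilation :: "real \<Rightarrow> ('b::metric_space \<Rightarrow> 'a::metric_space) \<Rightarrow> bool" where
  "dilation \<alpha> \<phi> \<longleftrightarrow> \<alpha> > 0 \<and> (\<forall>u v. dist (\<phi> u) (\<phi> v) = \<alpha> * dist u v)"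

text \<open>The supremum of the lengths of the inscribed polygons, over all partitions
  \<open>0 = t 0 \<le> \<dots> \<le> t n = 1\<close> of the parameter interval.\<close>

definition path_len :: "(real \<Rightarrow> 'a::metric_space) \<Rightarrow> ennreal" where
  "path_len g =
    (SUP (n, t)\<in>{(n :: nat, t :: nat \<Rightarrow> real). mono_on {..n} t \<and> t 0 = 0 \<and> t n = 1}.
       ennreal (\<Sum>i<n. dist (g (t i)) (g (t (Suc i)))))"

definition quasi_convex :: "'a::metric_space itself \<Rightarrow> bool" where
  "quasi_convex (_ :: 'a itself) \<longleftrightarrow>
    (\<exists>C>0. \<forall>x y :: 'a. \<exists>g. path g \<and> pathstart g = x \<and> pathfinish g = y \<and>
       path_len g \<le> ennreal (C * dist x y))"

end

theory Submission
  imports Defs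
begin

text \<open>Since \<open>h = T 1\<close> and \<open>L(T 1) = L(1) = 0\<close>, the function \<open>h\<close> is a constant \<open>c\<close>, and \<open>c \<noteq> 0\<close>
  because \<open>T\<close> is injective. Testing the isometry on truncated distance functions of \<open>X\<close>, and on
  preimages of truncated distance functions of \<open>Y\<close>, gives the two inequalities in
  \<open>\<bar>c\<bar> d(\<phi> u, \<phi> v) = d(u, v)\<close>. If \<open>\<phi>(Y)\<close> were not dense, the truncated distance to \<open>\<phi>(Y)\<close> would be
  a nonzero element of the kernel of \<open>T\<close>. All test functions are bounded, so cases (i) and (ii) have
  the same proof.\<close>

text \<open>Bridge from the extended-real supremum to the library's \<open>lipschitz_on\<close>.
  Pairs with \<open>x = y\<close> are vacuous on the left and give 0 \<le> 0 on the right.\<close>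

lemma Lip_const_le_iff:
  assumes "0 \<le> K"
  shows "Lip_const f \<le> ennreal K \<longleftrightarrow> K-lipschitz_on UNIV f"
proof -
  have "Lip_const f \<le> ennreal K \<longleftrightarrow> (\<forall>x y. x \<noteq> y \<longrightarrow> \<bar>f x - f y\<bar> / dist x y \<le> K)"
    using assms by (auto simp: Lip_const_def SUP_le_iff ennreal_le_iff)
  also have "\<dots> \<longleftrightarrow> (\<forall>x y. \<bar>f x - f y\<bar> \<le> K * dist x y)"
    by (intro iff_allI) (auto simp: pos_divide_le_eq)
  finally show ?thesis
    using assms by (simp add: lipschitz_on_def dist_real_def)
qed

lemma Lip_const_eq_0_iff: "Lip_const f = 0 \<longleftrightarrow> (\<forall>x y. f x = f y)"
  using Lip_const_le_iff[of 0 f] by (auto simp: lipschitz_on_def)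

lemma Lip_bddI:
  assumes "K-lipschitz_on UNIV f" "bounded (range f)"
  shows "f \<in> Lip_bdd"
proof -
  have "Lip_const f \<le> ennreal K"
    using assms lipschitz_on_nonneg Lip_const_le_iff by blast
  then have "Lip_const f < \<infinity>"
    using ennreal_less_top order_le_less_trans infinity_ennreal_def by metis
  then show ?thesis
    using assms by (simp add: Lip_bdd_def Lip_def)
qed

lemma const_in_Lip_bdd: "(\<lambda>_. c) \<in> Lip_bdd"
  by (rule Lip_bddI[of 0]) (auto simp: lipschitz_on_def)

lemma min_infdist_lipschitz: "1-lipschitz_on UNIV (\<lambda>x. min (infdist x S) r)"
proof (rule lipschitz_onI)
  fix x y :: 'a
  show "dist (min (infdist x S) r) (min (infdist y S) r) \<le> 1 * dist x y"
    using infdist_triangle_abs[of x S y] by (simp add: dist_real_def min_def abs_if split: if_splits)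
qed simp

lemma min_infdist_in_Lip_bdd:
  assumes "0 \<le> r"
  shows "(\<lambda>x. min (infdist x S) r) \<in> Lip_bdd"
proof (rule Lip_bddI[OF min_infdist_lipschitz])
  show "bounded (range (\<lambda>x. min (infdist x S) r))"
    by (rule bounded_subset[of "{0..r}"]) (use assms in \<open>auto simp: infdist_nonneg\<close>)
qed

text \<open>Letting \<open>A\<close> and \<open>B\<close> be any sets containing
  \<open>Lip_bdd\<close> covers both cases of the theorem: every test function below lies in
  \<open>Lip_bdd\<close>.\<close>

lemma weighted_composition_isometry:
  fixes \<phi> :: "'b::metric_space \<Rightarrow> 'a::metric_space"
    and h :: "'b \<Rightarrow> real"
    and T :: "('a \<Rightarrow> real) \<Rightarrow> ('b \<Rightarrow> real)"
  assumes T: "\<And>f. T f = (\<lambda>y. h y * f (\<phi> y))"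
    and bij: "bij_betw T A B"
    and iso: "\<And>f. f \<in> A \<Longrightarrow> Lip_const (T f) = Lip_const f"
    and A: "Lip_bdd \<subseteq> A" and B: "Lip_bdd \<subseteq> B"
  shows "\<exists>\<alpha>>0. dilation \<alpha> \<phi> \<and> closure (range \<phi>) = UNIV \<and>
    ((\<forall>y. h y = 1 / \<alpha>) \<or> (\<forall>y. h y = - 1 / \<alpha>))"
proof -
  have inj: "f = g" if "f \<in> Lip_bdd" "g \<in> Lip_bdd" "T f = T g" for f g
    using that A bij by (metis bij_betw_imp_inj_on inj_onD subsetD)
  have "Lip_const h = Lip_const (\<lambda>_::'a. 1)"
    using iso[of "\<lambda>_. 1"] const_in_Lip_bdd[of 1] A by (auto simp: T)
  also have "\<dots> = 0"
    by (simp add: Lip_const_eq_0_iff)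
  finally obtain c where c: "\<And>y. h y = c"
    by (metis Lip_const_eq_0_iff)
  have "c \<noteq> 0"
    using inj[OF const_in_Lip_bdd[of 0] const_in_Lip_bdd[of 1]] by (auto simp: T c fun_eq_iff)
  \<comment> \<open>Read forwards this yields \<open>upper\<close>; read backwards, through
    surjectivity of \<open>T\<close>, it yields \<open>lower\<close>.\<close>
  have Lip1_iff: "1-lipschitz_on UNIV (T f) \<longleftrightarrow> 1-lipschitz_on UNIV f" if "f \<in> A" for f
    using iso[OF that] Lip_const_le_iff[of 1 f] Lip_const_le_iff[of 1 "T f"] by simp
  have upper: "\<bar>c\<bar> * dist (\<phi> u) (\<phi> v) \<le> dist u v" for u v
  proof -
    \<comment> \<open>The cap makes \<open>?f\<close> bounded, yet leaves its value at
      \<open>\<phi> v\<close> equal to the full distance; at \<open>\<phi> u\<close> it is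
      0.\<close>
    let ?f = "\<lambda>x. min (infdist x {\<phi> u}) (dist (\<phi> u) (\<phi> v))"
    have "?f \<in> A"
      using min_infdist_in_Lip_bdd A by (metis subsetD zero_le_dist)
    then have "1-lipschitz_on UNIV (T ?f)"
      using Lip1_iff min_infdist_lipschitz by blast
    then have "dist (T ?f v) (T ?f u) \<le> dist v u"
      by (auto dest: lipschitz_onD)
    then show ?thesis
      by (simp add: T c dist_real_def abs_mult dist_commute)
  qed
  have lower: "dist u v \<le> \<bar>c\<bar> * dist (\<phi> u) (\<phi> v)" for u v
  proof -
    let ?g = "\<lambda>y. min (infdist y {u}) (dist u v)"
    have "?g \<in> B"
      using min_infdist_in_Lip_bdd B by (metis subsetD zero_le_dist)
    then obtain f where f: "f \<in> A" "T f = ?g"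
      using bij by (metis bij_betw_imp_surj_on imageE)
    then have "1-lipschitz_on UNIV f"
      using Lip1_iff min_infdist_lipschitz by metis
    then have "\<bar>f (\<phi> v) - f (\<phi> u)\<bar> \<le> dist (\<phi> u) (\<phi> v)"
      by (auto dest: lipschitz_onD[of _ _ _ "\<phi> v" "\<phi> u"] simp: dist_real_def dist_commute)
    \<comment> \<open>\<open>T f\<close> is \<open>?g\<close>, which is 0 at \<open>u\<close> and
      reaches its cap at \<open>v\<close>.\<close>
    moreover have "dist u v = \<bar>T f v - T f u\<bar>"
      by (simp add: f(2) dist_commute)
    moreover have "\<dots> = \<bar>c\<bar> * \<bar>f (\<phi> v) - f (\<phi> u)\<bar>"
      by (simp add: T c flip: abs_mult right_diff_distrib)
    ultimately show ?thesis
      by (simp add: mult_left_mono)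
  qed
  have "dist (\<phi> u) (\<phi> v) = 1 / \<bar>c\<bar> * dist u v" for u v
    using upper[of u v] lower[of u v] \<open>c \<noteq> 0\<close> by (simp add: field_simps)
  then have "dilation (1 / \<bar>c\<bar>) \<phi>"
    using \<open>c \<noteq> 0\<close> by (simp add: dilation_def)
  moreover have "closure (range \<phi>) = UNIV"
  proof -
    \<comment> \<open>\<open>?d\<close> vanishes on \<open>range \<phi>\<close>, the only place
      where \<open>T\<close> looks at it. Since the cap is positive, \<open>?d = 0\<close> forces
      the distance itself to vanish.\<close>
    let ?d = "\<lambda>x. min (infdist x (range \<phi>)) 1"
    have "T ?d = T (\<lambda>_. 0)"
      by (simp add: T)
    then have "?d = (\<lambda>_. 0)"
      using inj[OF min_infdist_in_Lip_bdd const_in_Lip_bdd] by simp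
    then have "infdist x (range \<phi>) = 0" for x
      by (metis min_def zero_neq_one)
    then show ?thesis
      by (auto simp: in_closure_iff_infdist_zero)
  qed
  ultimately show ?thesis
    \<comment> \<open>Here 1/\<alpha> is \<open>\<bar>c\<bar>\<close>, so the sign of
      \<open>c\<close> decides between the two alternatives for \<open>h\<close>.\<close>
    using \<open>c \<noteq> 0\<close> c by (intro exI[of _ "1 / \<bar>c\<bar>"]) (auto simp: abs_if)
qed

text \<open>A dilation reflects Cauchy sequences, with tolerances scaled by \<alpha>, and by
  continuity it carries the limit found in the domain back to the image.\<close>

lemma complete_range_dilation:
  fixes \<phi> :: "'b::metric_space \<Rightarrow> 'a::metric_space"
  assumes dil: "dilation \<alpha> \<phi>" and compl: "complete (UNIV :: 'b set)"
  shows "complete (range \<phi>)"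
proof (rule completeI)
  fix s assume "\<forall>n. s n \<in> range \<phi>" "Cauchy s"
  then have "\<forall>n. \<exists>y. s n = \<phi> y"
    by blast
  then obtain t where "\<forall>n. s n = \<phi> (t n)"
    by metis
  then have t: "s = \<phi> \<circ> t"
    by auto
  have "\<alpha> > 0" and dist: "dist (\<phi> u) (\<phi> v) = \<alpha> * dist u v" for u v
    using dil by (auto simp: dilation_def)
  have "Cauchy t"
  proof (rule metric_CauchyI)
    fix e :: real assume "e > 0"
    then obtain M where "\<forall>m\<ge>M. \<forall>n\<ge>M. dist (s m) (s n) < \<alpha> * e"
      using metric_CauchyD[OF \<open>Cauchy s\<close>, of "\<alpha> * e"] \<open>\<alpha> > 0\<close> by auto
    then show "\<exists>M. \<forall>m\<ge>M. \<forall>n\<ge>M. dist (t m) (t n) < e"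
      using \<open>\<alpha> > 0\<close> by (auto simp: t dist)
  qed
  then obtain l where l: "t \<longlonglongrightarrow> l"
    using compl by (auto simp: complete_def)
  have "continuous_on UNIV \<phi>"
    by (rule lipschitz_on_continuous_on[of \<alpha>]) (use \<open>\<alpha> > 0\<close> in \<open>simp add: lipschitz_on_def dist\<close>)
  from continuous_on_tendsto_compose[OF this l] have "s \<longlonglongrightarrow> \<phi> l"
    by (simp add: t comp_def)
  then show "\<exists>l\<in>range \<phi>. s \<longlonglongrightarrow> l"
    by blast
qed

theorem theorem2p3:
  fixes \<phi> :: "'b::metric_space \<Rightarrow> 'a::metric_space"
    and h :: "'b \<Rightarrow> real"
    and T :: "('a \<Rightarrow> real) \<Rightarrow> ('b \<Rightarrow> real)"
  assumes T_def: "\<And>f. T f = (\<lambda>y. h y * (f \<circ> \<phi>) y)"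
    and "(bij_betw T Lip Lip \<and> (\<forall>f\<in>Lip. Lip_const (T f) = Lip_const f)) \<or>
         (quasi_convex TYPE('a) \<and> quasi_convex TYPE('b) \<and>
          bij_betw T Lip_bdd Lip_bdd \<and> (\<forall>f\<in>Lip_bdd. Lip_const (T f) = Lip_const f))"
  shows "(\<exists>\<alpha>>0. dilation \<alpha> \<phi> \<and> closure (range \<phi>) = UNIV \<and>
            ((\<forall>y. h y = 1 / \<alpha>) \<or> (\<forall>y. h y = - 1 / \<alpha>))) \<and>
         (complete (UNIV :: 'b set) \<longrightarrow> range \<phi> = UNIV)"
proof -
  have T: "\<And>f. T f = (\<lambda>y. h y * f (\<phi> y))"
    by (simp add: T_def)
  have main: "\<exists>\<alpha>>0. dilation \<alpha> \<phi> \<and> closure (range \<phi>) = UNIV \<and>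
    ((\<forall>y. h y = 1 / \<alpha>) \<or> (\<forall>y. h y = - 1 / \<alpha>))"
    using assms(2)
  proof (elim disjE conjE)
    assume "bij_betw T Lip Lip" "\<forall>f\<in>Lip. Lip_const (T f) = Lip_const f"
    then show ?thesis
      by (intro weighted_composition_isometry[OF T]) (auto simp: Lip_bdd_def)
  next
    assume "bij_betw T Lip_bdd Lip_bdd" "\<forall>f\<in>Lip_bdd. Lip_const (T f) = Lip_const f"
    then show ?thesis
      by (intro weighted_composition_isometry[OF T]) auto
  qed
  \<comment> \<open>A complete subset is closed, so the dense image equals its closure.\<close>
  moreover have "range \<phi> = UNIV" if "complete (UNIV :: 'b set)"
    using main complete_range_dilation[OF _ that] complete_imp_closed closure_closed by metis
  ultimately show ?thesis
    by blast
qed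

end
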